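(* Let $N\ge 1$ and let $\mathbf{A},\mathbf{B},\mathbf{C}$ be $N\times N$ complex matrices with $\mathbf{A}$ invertible. Let $$\mathbf{M}(\lambda)=\begin{bmatrix}\lambda\mathbf{1} & -\mathbf{1}\\ \mathbf{A}^{-1}\mathbf{C} & \lambda\mathbf{1}+\mathbf{A}^{-1}\mathbf{B}\end{bmatrix},\qquad \mathbf{S}(\lambda)=\lambda^{2}\mathbf{1}+\lambda\mathbf{A}^{-1}\mathbf{B}+\mathbf{A}^{-1}\mathbf{C}.$$ Then $\mathbf{M}(\lambda)$ is diagonalizable if and only if there exist $N\times N$ matrices $\mathbf{V}_1,\mathbf{Q},\mathbf{D}_1,\mathbf{D}_2$ (independent of $\lambda$), with $\mathbf{D}_1,\mathbf{D}_2$ diagonal and $$\det\mathbf{V}_1\neq 0,\qquad \det(\mathbf{D}_1\mathbf{Q}-\mathbf{Q}\mathbf{D}_2)\neq 0,$$ such that for all $\lambda$ $$\mathbf{S}(\lambda)=(\lambda\mathbf{1}-\mathbf{A}_2)(\lambda\mathbf{1}-\mathbf{A}_1),$$ where $$\mathbf{A}_1=\mathbf{V}_1\mathbf{D}_1\mathbf{V}_1^{-1},\qquad \mathbf{A}_2=\mathbf{V}_1(\mathbf{D}_1\mathbf{Q}-\mathbf{Q}\mathbf{D}_2)\,\mathbf{D}_2\,\bigl(\mathbf{V}_1(\mathbf{D}_1\mathbf{Q}-\mathbf{Q}\mathbf{D}_2)\bigr)^{-1}.$$ This factorization means that $\mathbf{A}^{-1}\mathbf{C}=\mathbf{A}_2\mathbf{A}_1$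 and $\mathbf{A}^{-1}\mathbf{B}=-(\mathbf{A}_1+\mathbf{A}_2)$.
   Context: The matrices arise from a constant-coefficient second-order system $(\mathbf{A}\partial_t^2+\mathbf{B}^i\partial_i\partial_t+\mathbf{C}^{ij}\partial_i\partial_j)\phi=0$ with $\mathbf{A}$ invertible, by fixing a unit wave covector $\hat k_i$ and putting $\mathbf{B}=\mathbf{B}^i\hat k_i$, $\mathbf{C}=\mathbf{C}^{ij}\hat k_i\hat k_j$. Here $\mathbf{1}$ is the $N\times N$ identity and $\lambda\in\mathbb{C}$ is a parameter. $\mathbf{M}(\lambda)$ is called diagonalizable if there are an invertible $2N\times 2N$ matrix $\mathbf{P}$ and a diagonal $2N\times 2N$ matrix $\mathbf{D}$, both independent of $\lambda$, with $\mathbf{M}(\lambda)=\mathbf{P}(\lambda\mathbf{1}_{2N}-\mathbf{D})\mathbf{P}^{-1}$ for all $\lambda$. *)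

theory Defs
  imports "HOL-Analysis.Analysis"
begin

definition diagonal_matrix :: "'a::zero^'n^'n \<Rightarrow> bool" where
  "diagonal_matrix D \<longleftrightarrow> (\<forall>i j. i \<noteq> j \<longrightarrow> D $ i $ j = 0)"

abbreviation smult_matrix :: "'a::times \<Rightarrow> 'a^'n^'m \<Rightarrow> 'a^'n^'m" (infixr "*\<^sub>m" 75) where
  "c *\<^sub>m X \<equiv> map_matrix ((*) c) X"

definition block_matrix ::
  "'a^'n^'m \<Rightarrow> 'a^'p^'m \<Rightarrow> 'a^'n^'q \<Rightarrow> 'a^'p^'q \<Rightarrow> 'a^('n + 'p)^('m + 'q)" where
  "block_matrix W X Y Z = (\<chi> i j.
     (case i of
        Inl a \<Rightarrow> (case j of Inl b \<Rightarrow> W $ a $ b | Inr b \<Rightarrow> X $ a $ b)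
      | Inr a \<Rightarrow> (case j of Inl b \<Rightarrow> Y $ a $ b | Inr b \<Rightarrow> Z $ a $ b)))"

text \<open>
  Below, \<open>mat c\<close> is the library's scalar matrix, that is, \<open>c\<close> times the identity.
  The index type \<open>'n\<close> has \<open>N\<close> elements and \<open>'n + 'n\<close> has \<open>2N\<close>.
\<close>

definition M_pencil ::
  "complex^'n^'n \<Rightarrow> complex^'n^'n \<Rightarrow> complex^'n^'n \<Rightarrow> complex \<Rightarrow> complex^('n + 'n)^('n + 'n)" where
  "M_pencil A B C l =
     block_matrix (mat l) (- mat 1)
                  (matrix_inv A ** C) (mat l + matrix_inv A ** B)"

definition S_pencil ::
  "complex^'n^'n \<Rightarrow> complex^'n^'n \<Rightarrow> complex^'n^'n \<Rightarrow> complex \<Rightarrow> complex^'n^'n" where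
  "S_pencil A B C l = mat (l\<^sup>2) + l *\<^sub>m (matrix_inv A ** B) + matrix_inv A ** C"

text \<open>
  Diagonalizability is a property of the whole family \<open>l \<mapsto> M l\<close>:
  \<open>P\<close> and \<open>D\<close> are chosen before \<open>l\<close>.
\<close>

definition diagonalizable_pencil :: "(complex \<Rightarrow> complex^'m^'m) \<Rightarrow> bool" where
  "diagonalizable_pencil M \<longleftrightarrow>
     (\<exists>P D :: complex^'m^'m. invertible P \<and> diagonal_matrix D \<and>
            (\<forall>l. M l = P ** (mat l - D) ** matrix_inv P))"

definition right_factor :: "complex^'n^'n \<Rightarrow> complex^'n^'n \<Rightarrow> complex^'n^'n" where
  "right_factor V1 D1 = V1 ** D1 ** matrix_inv V1"

definition left_factor ::
  "complex^'n^'n \<Rightarrow> complex^'n^'n \<Rightarrow> complex^'n^'n \<Rightarrow> complex^'n^'n \<Rightarrow> complex^'n^'n" where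
  "left_factor V1 Q D1 D2 =
     (let T = V1 ** (D1 ** Q - Q ** D2) in T ** D2 ** matrix_inv T)"

end

theory Submission
  imports Defs
begin

text \<open>
  Write \<open>F = A\<inverse>C\<close> and \<open>G = A\<inverse>B\<close>. Then \<open>M(l) = l - K\<close>, where \<open>K\<close> is the companion
  matrix with block rows \<open>(0, 1)\<close> and \<open>(-F, -G)\<close>, so diagonalizability of the pencil says that
  \<open>K P = P D\<close> for an invertible \<open>P\<close> and a diagonal \<open>D\<close> with diagonal blocks \<open>D1\<close>, \<open>D2\<close>. By the
  first block row of \<open>K\<close>, such a \<open>P\<close> has block rows \<open>(V1, V2)\<close> and \<open>(V1 D1, V2 D2)\<close>; the second
  block row says that each pair \<open>V, D\<close> satisfies the quadratic equation \<open>F V + G V D + V D\<^sup>2 = 0\<close>.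

  The upper block row \<open>(V1, V2)\<close> of an invertible \<open>P\<close> has full row rank, so some \<open>N\<close> of its columns
  form an invertible matrix. Reordering the eigenvectors puts those columns first: one may take
  \<open>V1\<close> invertible, and then \<open>V2 = V1 Q\<close> for some \<open>Q\<close>. This is
  \<open>companion_diagonalizable_iff\<close>, and it is where the two halves of the spectrum are chosen.

  Now let \<open>R = V1 D1 V1\<inverse>\<close> and \<open>T = R V2 - V2 D2 = V1 (D1 Q - Q D2)\<close>. Eliminating the lower left
  block of \<open>P\<close> leaves \<open>V1\<close> and \<open>-T\<close> on the diagonal, so \<open>P\<close> is invertible exactly when \<open>T\<close> is
  (\<open>invertible_two_solvents_iff\<close>). The equation for \<open>V1\<close> says that \<open>F = L' R\<close> with
  \<open>L' = -(G + R)\<close>, that is, that the quadratic \<open>S(l)\<close> has the right factor \<open>l - R\<close> with quotient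
  \<open>l - L'\<close>. Granted this, the left side of the equation for \<open>V2\<close> becomes \<open>L' T - T D2\<close>, so the
  equation says precisely \<open>L' = T D2 T\<inverse>\<close>
  (\<open>eigenvector_equations_iff_factorization\<close>). Both directions of the theorem follow from this
  chain of equivalences.
\<close>

section \<open>Ring identities and inverses of matrices\<close>

lemma matrix_mul_minus_left: "(- X) ** Y = - (X ** Y)"
  for X :: "'a::comm_ring_1^'n^'m"
  by (simp add: matrix_matrix_mult_def vec_eq_iff sum_negf)

lemma matrix_mul_minus_right: "X ** (- Y) = - (X ** Y)"
  for X :: "'a::comm_ring_1^'n^'m"
  by (simp add: matrix_matrix_mult_def vec_eq_iff sum_negf)

lemma matrix_diff_rdistrib: "(X - Y) ** Z = X ** Z - Y ** Z"
  for X Y :: "'a::comm_ring_1^'n^'m"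
  by (simp add: matrix_matrix_mult_def vec_eq_iff left_diff_distrib sum_subtractf)

lemma matrix_diff_ldistrib: "X ** (Y - Z) = X ** Y - X ** Z"
  for X :: "'a::comm_ring_1^'n^'m"
  by (simp add: matrix_matrix_mult_def vec_eq_iff right_diff_distrib sum_subtractf)

lemma matrix_add_rdistrib: "(X + Y) ** Z = X ** Z + Y ** Z"
  for X Y :: "'a::comm_ring_1^'n^'m"
  by (simp add: matrix_matrix_mult_def vec_eq_iff distrib_right sum.distrib)

lemmas matrix_ring_simps =
  matrix_mul_minus_left matrix_mul_minus_right matrix_diff_rdistrib matrix_diff_ldistrib
  matrix_add_rdistrib matrix_add_ldistrib matrix_mul_assoc

lemma mat_matrix_mult: "mat l ** X = l *\<^sub>m X"
  for X :: "'a::comm_ring_1^'n^'m"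
  by (simp add: matrix_matrix_mult_def vec_eq_iff mat_def if_distrib[of "\<lambda>a. a * _"] cong: if_cong)

lemma matrix_mult_mat: "X ** mat l = l *\<^sub>m X"
  for X :: "'a::comm_ring_1^'n^'m"
  by (simp add: matrix_matrix_mult_def vec_eq_iff mat_def if_distrib[of "\<lambda>a. _ * a"] mult.commute
      cong: if_cong)

lemma
  fixes P :: "'a::comm_ring_1^'n^'n"
  assumes "invertible P"
  shows matrix_inv_mult_right: "P ** matrix_inv P = mat 1"
    and matrix_inv_mult_left: "matrix_inv P ** P = mat 1"
proof -
  have "P ** matrix_inv P = mat 1 \<and> matrix_inv P ** P = mat 1"
    using assms unfolding invertible_def matrix_inv_def by (rule someI_ex)
  then show "P ** matrix_inv P = mat 1" "matrix_inv P ** P = mat 1" by auto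
qed

lemma invertible_mult_right_cancel:
  fixes P :: "'a::comm_ring_1^'n^'n" and X Y :: "'a^'n^'m"
  assumes "invertible P"
  shows "X ** P = Y ** P \<longleftrightarrow> X = Y"
proof
  assume "X ** P = Y ** P"
  then have "X ** (P ** matrix_inv P) = Y ** (P ** matrix_inv P)"
    by (simp add: matrix_mul_assoc)
  then show "X = Y" by (simp add: matrix_inv_mult_right assms)
qed simp

lemma conjugate_mult:
  fixes P :: "'a::comm_ring_1^'n^'n"
  assumes "invertible P"
  shows "(P ** D ** matrix_inv P) ** P = P ** D"
  by (simp add: matrix_inv_mult_left assms flip: matrix_mul_assoc)

section \<open>Block matrices\<close>

lemma sum_UNIV_Plus:
  "(\<Sum>k\<in>(UNIV :: ('a::finite + 'b::finite) set). f k)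
     = (\<Sum>a\<in>UNIV. f (Inl a)) + (\<Sum>b\<in>UNIV. f (Inr b))"
  using sum.Plus[of "UNIV :: 'a set" "UNIV :: 'b set" f] by (simp add: comp_def)

lemma block_matrix_nth [simp]:
  "block_matrix W X Y Z $ Inl a $ Inl b = W $ a $ b"
  "block_matrix W X Y Z $ Inl a $ Inr d = X $ a $ d"
  "block_matrix W X Y Z $ Inr c $ Inl b = Y $ c $ b"
  "block_matrix W X Y Z $ Inr c $ Inr d = Z $ c $ d"
  by (simp_all add: block_matrix_def)

lemma block_matrix_mult:
  "block_matrix W X Y Z ** block_matrix W' X' Y' Z' =
     block_matrix (W ** W' + X ** Y') (W ** X' + X ** Z') (Y ** W' + Z ** Y') (Y ** X' + Z ** Z')"
  (is "?L = ?R")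
proof -
  have "?L $ i $ j = ?R $ i $ j" for i j
    by (cases i; cases j) (simp_all add: matrix_matrix_mult_def sum_UNIV_Plus)
  then show ?thesis by (simp add: vec_eq_iff)
qed

lemma block_matrix_eq_iff:
  "block_matrix W X Y Z = block_matrix W' X' Y' Z' \<longleftrightarrow> W = W' \<and> X = X' \<and> Y = Y' \<and> Z = Z'"
proof
  assume eq: "block_matrix W X Y Z = block_matrix W' X' Y' Z'"
  have *: "block_matrix W X Y Z $ i $ j = block_matrix W' X' Y' Z' $ i $ j" for i j
    by (simp add: eq)
  have "W $ a $ b = W' $ a $ b" for a b using *[of "Inl a" "Inl b"] by simp
  moreover have "X $ a $ b = X' $ a $ b" for a b using *[of "Inl a" "Inr b"] by simp
  moreover have "Y $ a $ b = Y' $ a $ b" for a b using *[of "Inr a" "Inl b"] by simp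
  moreover have "Z $ a $ b = Z' $ a $ b" for a b using *[of "Inr a" "Inr b"] by simp
  ultimately show "W = W' \<and> X = X' \<and> Y = Y' \<and> Z = Z'"
    by (simp add: vec_eq_iff)
qed simp

lemma block_matrix_exists:
  obtains W X Y Z where "U = block_matrix W X Y Z"
proof
  let ?B = "block_matrix (\<chi> a b. U $ Inl a $ Inl b) (\<chi> a b. U $ Inl a $ Inr b)
                         (\<chi> a b. U $ Inr a $ Inl b) (\<chi> a b. U $ Inr a $ Inr b)"
  have "U $ i $ j = ?B $ i $ j" for i j
    by (cases i; cases j) simp_all
  then show "U = ?B" unfolding vec_eq_iff by blast
qed

lemma mat_block:
  "(mat l :: 'a::zero^('n::finite + 'm::finite)^('n + 'm)) = block_matrix (mat l) 0 0 (mat l)"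
proof -
  have "(mat l :: 'a^('n + 'm)^('n + 'm)) $ i $ j = block_matrix (mat l) 0 0 (mat l) $ i $ j" for i j
    by (cases i; cases j) (simp_all add: mat_def)
  then show ?thesis by (simp add: vec_eq_iff)
qed

lemma diagonal_block_iff:
  "diagonal_matrix (block_matrix D1 X Y D2) \<longleftrightarrow>
     diagonal_matrix D1 \<and> X = 0 \<and> Y = 0 \<and> diagonal_matrix D2"
proof
  assume "diagonal_matrix (block_matrix D1 X Y D2)"
  then have *: "block_matrix D1 X Y D2 $ i $ j = 0" if "i \<noteq> j" for i j
    using that by (simp add: diagonal_matrix_def)
  have "D1 $ a $ b = 0" if "a \<noteq> b" for a b using *[of "Inl a" "Inl b"] that by simp
  moreover have "X $ a $ b = 0" for a b using *[of "Inl a" "Inr b"] by simp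
  moreover have "Y $ a $ b = 0" for a b using *[of "Inr a" "Inl b"] by simp
  moreover have "D2 $ a $ b = 0" if "a \<noteq> b" for a b using *[of "Inr a" "Inr b"] that by simp
  ultimately show "diagonal_matrix D1 \<and> X = 0 \<and> Y = 0 \<and> diagonal_matrix D2"
    by (simp add: diagonal_matrix_def vec_eq_iff)
next
  assume *: "diagonal_matrix D1 \<and> X = 0 \<and> Y = 0 \<and> diagonal_matrix D2"
  have "block_matrix D1 X Y D2 $ i $ j = 0" if "i \<noteq> j" for i j
    using * that by (cases i; cases j) (simp_all add: diagonal_matrix_def)
  then show "diagonal_matrix (block_matrix D1 X Y D2)"
    by (simp add: diagonal_matrix_def)
qed

lemma invertible_block_upper_iff:
  fixes W :: "'a::field^'n^'n" and Z :: "'a^'m^'m"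
  assumes "invertible W"
  shows "invertible (block_matrix W X 0 Z) \<longleftrightarrow> invertible Z"
proof
  assume "invertible (block_matrix W X 0 Z)"
  then obtain U where U: "block_matrix W X 0 Z ** U = mat 1"
    by (auto simp: invertible_right_inverse)
  obtain W' X' Y' Z' where "U = block_matrix W' X' Y' Z'"
    by (rule block_matrix_exists)
  with U have "Z ** Z' = mat 1"
    by (simp add: block_matrix_mult block_matrix_eq_iff mat_block)
  then show "invertible Z"
    by (auto simp: invertible_right_inverse)
next
  assume Z: "invertible Z"
  let ?U = "block_matrix (matrix_inv W) (- (matrix_inv W ** X ** matrix_inv Z)) 0 (matrix_inv Z)"
  have "block_matrix W X 0 Z ** ?U = mat 1"
    by (simp add: block_matrix_mult mat_block matrix_ring_simps
        matrix_inv_mult_right assms Z)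
  then show "invertible (block_matrix W X 0 Z)"
    unfolding invertible_right_inverse by (rule exI)
qed

text \<open>
  Adding \<open>-R\<close> times the upper block row to the lower one kills the lower left block, because
  \<open>R V1 = V1 D1\<close>, and leaves the negative of the Sylvester expression \<open>R V2 - V2 D2\<close> as the lower
  right block.
\<close>

lemma invertible_two_solvents_iff:
  fixes V1 V2 D1 D2 R :: "'a::field^'n^'n"
  assumes V1: "invertible V1" and R: "R ** V1 = V1 ** D1"
  shows "invertible (block_matrix V1 V2 (V1 ** D1) (V2 ** D2)) \<longleftrightarrow> invertible (R ** V2 - V2 ** D2)"
proof -
  let ?P = "block_matrix V1 V2 (V1 ** D1) (V2 ** D2)"
  let ?U = "block_matrix V1 V2 0 (V2 ** D2 - R ** V2)"
  have elim: "block_matrix (mat 1) 0 (- R) (mat 1) ** ?P = ?U"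
    by (simp add: block_matrix_mult matrix_ring_simps R)
  have undo_elim: "block_matrix (mat 1) 0 R (mat 1) ** ?U = ?P"
    by (simp add: block_matrix_mult matrix_ring_simps R)
  have inverse: "block_matrix (mat 1) 0 (- S) (mat 1) ** block_matrix (mat 1) 0 S (mat 1) = mat 1"
    for S :: "'a^'n^'n"
    by (simp add: block_matrix_mult mat_block)
  have unit: "invertible (block_matrix (mat 1) 0 S (mat 1))" for S :: "'a^'n^'n"
    unfolding invertible_left_inverse using inverse by (rule exI)
  have "invertible ?P \<longleftrightarrow> invertible ?U"
    using invertible_mult[OF unit[of "- R"], of ?P] invertible_mult[OF unit[of R], of ?U]
    by (auto simp: elim undo_elim)
  also have "\<dots> \<longleftrightarrow> invertible (- (R ** V2 - V2 ** D2))"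
    by (simp add: invertible_block_upper_iff V1)
  also have "\<dots> \<longleftrightarrow> invertible (R ** V2 - V2 ** D2)"
    unfolding invertible_right_inverse
    by (metis matrix_mul_minus_left matrix_mul_minus_right minus_minus)
  finally show ?thesis .
qed

section \<open>Choosing an invertible set of columns\<close>

text \<open>
  A right inverse makes the columns span the whole space, so a maximal independent set of columns
  is a basis, with exactly as many elements as there are rows.
\<close>

lemma invertible_column_selection:
  fixes X :: "'a::field^'m^'n"
  assumes "X ** Y = mat 1"
  obtains c :: "'n \<Rightarrow> 'm" where "inj c" "invertible (\<chi> i j. X $ i $ c j)"
proof -
  have span: "vec.span (columns X) = UNIV"
    using assms matrix_right_invertible_span_columns[of X] by blast
  obtain S where S: "S \<subseteq> columns X" "vec.independent S" "columns X \<subseteq> vec.span S"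
    by (rule vec.maximal_independent_subset)
  have span_S: "vec.span S = UNIV"
    using span vec.span_mono[OF S(3)] by (simp add: vec.span_span top_unique)
  then have "vec.dim (UNIV :: ('a^'n) set) = card S"
    by (intro vec.dim_eq_card S(2)) (simp only: vec.span_UNIV)
  then have card_S: "card S = CARD('n)"
    by (simp only: vec_dim_card)
  then have "finite S"
    by (metis card.infinite finite_UNIV_card_ge_0 finite less_irrefl)
  then obtain h where h: "bij_betw h (UNIV :: 'n set) S"
    using card_S finite_same_card_bij[of "UNIV :: 'n set" S] by auto
  have "\<exists>k. h j = column k X" for j
    using h S(1) by (auto simp: bij_betw_def columns_def)
  then obtain c where c: "h j = column (c j) X" for j
    by metis
  have "inj c"
    using h c by (metis bij_betw_def injI inj_eq)
  moreover have "columns (\<chi> i j. X $ i $ c j) = S"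
    using h c by (auto simp: columns_def column_def bij_betw_def)
  then have "invertible (\<chi> i j. X $ i $ c j)"
    using span_S matrix_right_invertible_span_columns[of "\<chi> i j. X $ i $ c j"]
    by (simp add: invertible_right_inverse)
  ultimately show ?thesis by (rule that)
qed

text \<open>
  This turns a choice of \<open>N\<close> out of \<open>2N\<close> columns into a reordering of all columns that moves the
  chosen ones to the front; the complement of the choice also has \<open>N\<close> elements.
\<close>

lemma extend_inj_to_bij_Plus:
  fixes c :: "'n::finite \<Rightarrow> 'n + 'n"
  assumes "inj c"
  obtains p :: "'n + 'n \<Rightarrow> 'n + 'n" where "bij p" "\<And>j. p (Inl j) = c j"
proof -
  have "card (- range c) = CARD('n)"
    using card_image[OF assms] by (simp add: Compl_eq_Diff_UNIV card_Diff_subset)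
  then obtain d where d: "bij_betw d (UNIV :: 'n set) (- range c)"
    using finite_same_card_bij[of "UNIV :: 'n set" "- range c"] by auto
  have "inj (case_sum c d)"
    using assms d by (auto simp: inj_def bij_betw_def split: sum.split; blast)
  then have "bij (case_sum c d)"
    by (simp add: finite_UNIV_inj_surj bij_def)
  then show ?thesis by (rule that) simp
qed

lemma permute_eigenvectors:
  fixes K P D :: "'a::field^'m^'m" and p :: "'m \<Rightarrow> 'm"
  assumes "bij p" "invertible P" "diagonal_matrix D" "K ** P = P ** D"
  defines "P' \<equiv> \<chi> i j. P $ i $ p j" and "D' \<equiv> \<chi> i j. D $ p i $ p j"
  shows "invertible P'" "diagonal_matrix D'" "K ** P' = P' ** D'"
proof -
  have reindex: "(\<Sum>k\<in>UNIV. f (p k)) = (\<Sum>k\<in>UNIV. f k)" for f :: "'m \<Rightarrow> 'a"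
    using sum.reindex_bij_betw[of p UNIV UNIV f] assms(1) by simp
  obtain U where "P ** U = mat 1"
    using assms(2) by (auto simp: invertible_right_inverse)
  then have "P' ** (\<chi> i j. U $ p i $ j) = mat 1"
    by (simp add: P'_def matrix_matrix_mult_def reindex[of "\<lambda>k. P $ _ $ k * U $ k $ _"])
  then show "invertible P'"
    unfolding invertible_right_inverse by (rule exI)
  show "diagonal_matrix D'"
    using assms(1,3) by (auto simp: diagonal_matrix_def D'_def bij_def inj_eq)
  have "(K ** P) $ i $ p j = (P ** D) $ i $ p j" for i j
    by (simp add: assms(4))
  then show "K ** P' = P' ** D'"
    by (simp add: vec_eq_iff P'_def D'_def matrix_matrix_mult_def
        reindex[of "\<lambda>k. P $ _ $ k * D $ k $ p _"])
qed

section \<open>The companion matrix and its eigenvectors\<close>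

definition companion_matrix :: "'a::comm_ring_1^'n^'n \<Rightarrow> 'a^'n^'n \<Rightarrow> 'a^('n + 'n)^('n + 'n)" where
  "companion_matrix F G = block_matrix 0 (mat 1) (- F) (- G)"

lemma M_pencil_companion:
  fixes A B C :: "complex^'n^'n"
  shows "M_pencil A B C l = mat l - companion_matrix (matrix_inv A ** C) (matrix_inv A ** B)"
proof -
  have "M_pencil A B C l $ i $ j =
      (mat l - companion_matrix (matrix_inv A ** C) (matrix_inv A ** B)) $ i $ j" for i j
    by (cases i; cases j)
      (simp_all add: M_pencil_def companion_matrix_def mat_def)
  then show ?thesis by (simp add: vec_eq_iff)
qed

lemma diagonalizable_pencil_iff:
  fixes K :: "complex^'m^'m"
  shows "diagonalizable_pencil (\<lambda>l. mat l - K) \<longleftrightarrow>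
     (\<exists>P D :: complex^'m^'m. invertible P \<and> diagonal_matrix D \<and> K ** P = P ** D)"
proof -
  have "(\<forall>l. mat l - K = P ** (mat l - D) ** matrix_inv P) \<longleftrightarrow> K ** P = P ** D"
    if P: "invertible P" for P D :: "complex^'m^'m"
  proof -
    have "P ** mat l ** matrix_inv P = mat l" for l
      using matrix_inv_mult_right[OF P]
      by (metis mat_matrix_mult matrix_mult_mat matrix_mul_assoc matrix_mul_rid)
    then have "(\<forall>l. mat l - K = P ** (mat l - D) ** matrix_inv P) \<longleftrightarrow> K = P ** D ** matrix_inv P"
      by (simp add: matrix_diff_ldistrib matrix_diff_rdistrib)
    also have "\<dots> \<longleftrightarrow> K ** P = (P ** D ** matrix_inv P) ** P"
      by (simp only: invertible_mult_right_cancel[OF P])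
    finally show ?thesis by (simp only: conjugate_mult[OF P])
  qed
  then show ?thesis unfolding diagonalizable_pencil_def by meson
qed

text \<open>
  An eigenvector of the companion matrix for the eigenvalue \<open>d\<close> is \<open>(v, d v)\<close> with
  \<open>(F + d G + d\<^sup>2) v = 0\<close>. Here this is stated for all eigenvectors at once, collected as the
  columns of two block columns.
\<close>

lemma companion_eigenvectors_iff:
  fixes F G V1 V2 Y1 Y2 D1 D2 :: "'a::comm_ring_1^'n^'n"
  shows "companion_matrix F G ** block_matrix V1 V2 Y1 Y2
       = block_matrix V1 V2 Y1 Y2 ** block_matrix D1 0 0 D2 \<longleftrightarrow>
     Y1 = V1 ** D1 \<and> Y2 = V2 ** D2 \<and>
     F ** V1 + G ** V1 ** D1 + V1 ** D1 ** D1 = 0 \<and>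
     F ** V2 + G ** V2 ** D2 + V2 ** D2 ** D2 = 0"
proof -
  have K: "companion_matrix F G ** block_matrix V1 V2 Y1 Y2
      = block_matrix Y1 Y2 (- (F ** V1 + G ** Y1)) (- (F ** V2 + G ** Y2))"
    by (simp add: companion_matrix_def block_matrix_mult matrix_ring_simps)
  have D: "block_matrix V1 V2 Y1 Y2 ** block_matrix D1 0 0 D2
      = block_matrix (V1 ** D1) (V2 ** D2) (Y1 ** D1) (Y2 ** D2)"
    by (simp add: block_matrix_mult)
  show ?thesis
    unfolding K D block_matrix_eq_iff neg_eq_iff_add_eq_0
    by (simp only: matrix_mul_assoc cong: conj_cong)
qed

text \<open>
  The algebraic heart of the proof. The equation for \<open>V1\<close> alone makes \<open>R\<close> a right root of the
  quadratic, which forces the left root to be \<open>-(G + R)\<close>. The equation for \<open>V2\<close> then says that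
  the columns of \<open>T\<close> are eigenvectors of that left root with eigenvalues \<open>D2\<close>, which for
  invertible \<open>T\<close> determines it.
\<close>

lemma eigenvector_equations_iff_factorization:
  fixes F G V1 V2 D1 D2 R L :: "'a::field^'n^'n"
  defines "T \<equiv> R ** V2 - V2 ** D2"
  assumes V1: "invertible V1" and T: "invertible T"
    and R: "R ** V1 = V1 ** D1" and L: "L ** T = T ** D2"
  shows "F ** V1 + G ** V1 ** D1 + V1 ** D1 ** D1 = 0 \<and>
         F ** V2 + G ** V2 ** D2 + V2 ** D2 ** D2 = 0 \<longleftrightarrow>
         F = L ** R \<and> G = - (R + L)"
proof -
  define L' where "L' = - (G + R)"
  have G: "G = - (R + L')" by (simp add: L'_def)
  have "(F - L' ** R) ** V1 = F ** V1 + G ** V1 ** D1 + V1 ** D1 ** D1"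
    unfolding L'_def
    by (simp add: matrix_ring_simps)
      (simp add: R flip: matrix_mul_assoc, simp add: R matrix_mul_assoc)
  then have first: "F ** V1 + G ** V1 ** D1 + V1 ** D1 ** D1 = 0 \<longleftrightarrow> F = L' ** R"
    using invertible_mult_right_cancel[OF V1, of "F - L' ** R" 0] by simp
  have second: "F ** V2 + G ** V2 ** D2 + V2 ** D2 ** D2 = 0 \<longleftrightarrow> L' = L" if "F = L' ** R"
  proof -
    have "F ** V2 + G ** V2 ** D2 + V2 ** D2 ** D2 = L' ** T - T ** D2"
      unfolding G that T_def by (simp add: matrix_ring_simps)
    also have "\<dots> = 0 \<longleftrightarrow> L' = L"
      using invertible_mult_right_cancel[OF T, of L' L] L by simp
    finally show ?thesis .
  qed
  have "L' = L \<longleftrightarrow> G = - (R + L)" unfolding G by auto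
  with first second show ?thesis by blast
qed

text \<open>
  Both sides are monic quadratic in \<open>l\<close>, so their difference is affine in \<open>l\<close>; comparing at
  \<open>l = 0\<close> and \<open>l = 1\<close> therefore gives the remaining coefficients.
\<close>

lemma factorization_iff_coefficients:
  fixes F G R L :: "'a::field^'n^'n"
  shows "(\<forall>l. mat (l\<^sup>2) + l *\<^sub>m G + F = (mat l - L) ** (mat l - R)) \<longleftrightarrow>
         F = L ** R \<and> G = - (R + L)"
proof -
  have expand: "(mat l - L) ** (mat l - R) = mat (l\<^sup>2) + mat l ** (- (R + L)) + L ** R" for l
  proof -
    have "mat l ** mat l = (mat (l\<^sup>2) :: 'a^'n^'n)"
      by (simp add: mat_matrix_mult) (simp add: mat_def vec_eq_iff power2_eq_square)
    moreover have "L ** mat l = mat l ** L"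
      by (simp add: mat_matrix_mult matrix_mult_mat)
    ultimately show ?thesis by (simp add: matrix_ring_simps)
  qed
  have "(\<forall>l. mat (l\<^sup>2) + l *\<^sub>m G + F = (mat l - L) ** (mat l - R)) \<longleftrightarrow>
        (\<forall>l. mat l ** G + F = mat l ** (- (R + L)) + L ** R)"
    by (simp only: expand mat_matrix_mult[symmetric] add.assoc add_left_cancel)
  also have "\<dots> \<longleftrightarrow> F = L ** R \<and> G = - (R + L)"
  proof
    assume *: "\<forall>l. mat l ** G + F = mat l ** (- (R + L)) + L ** R"
    show "F = L ** R \<and> G = - (R + L)"
      using *[rule_format, of 0] *[rule_format, of 1] by simp
  qed simp
  finally show ?thesis .
qed

section \<open>Diagonalizability and factorization\<close>

text \<open>
  The point is that \<open>V1\<close> can be made invertible: \<open>P\<close> being invertible gives its upper half a right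
  inverse, hence an invertible selection of columns, and reordering the columns of \<open>P\<close> together
  with the diagonal entries of \<open>D\<close> keeps \<open>P\<close> a matrix of eigenvectors.
\<close>

lemma companion_diagonalizable_iff:
  fixes F G :: "complex^'n^'n"
  shows "diagonalizable_pencil (\<lambda>l. mat l - companion_matrix F G) \<longleftrightarrow>
     (\<exists>(V1 :: complex^'n^'n) (V2 :: complex^'n^'n) D1 D2.
        invertible V1 \<and> diagonal_matrix D1 \<and> diagonal_matrix D2 \<and>
        invertible (block_matrix V1 V2 (V1 ** D1) (V2 ** D2)) \<and>
        F ** V1 + G ** V1 ** D1 + V1 ** D1 ** D1 = 0 \<and>
        F ** V2 + G ** V2 ** D2 + V2 ** D2 ** D2 = 0)" (is "?L \<longleftrightarrow> ?R")
proof
  assume ?L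
  then obtain P D :: "complex^('n + 'n)^('n + 'n)"
    where P: "invertible P" and D: "diagonal_matrix D"
    and eigen: "companion_matrix F G ** P = P ** D"
    by (auto simp: diagonalizable_pencil_iff)
  define X :: "complex^('n + 'n)^'n" where "X = (\<chi> i j. P $ Inl i $ j)"
  have "X ** (\<chi> i j. matrix_inv P $ i $ Inl j) = mat 1"
  proof -
    have "(P ** matrix_inv P) $ Inl i $ Inl j = mat 1 $ i $ j" for i j
      by (simp add: matrix_inv_mult_right P mat_def)
    then show ?thesis by (simp add: X_def matrix_matrix_mult_def vec_eq_iff)
  qed
  then obtain c :: "'n \<Rightarrow> 'n + 'n" where c: "inj c" "invertible (\<chi> i j. X $ i $ c j)"
    by (rule invertible_column_selection)
  obtain p :: "'n + 'n \<Rightarrow> 'n + 'n" where p: "bij p" "\<And>j. p (Inl j) = c j"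
    using c(1) by (rule extend_inj_to_bij_Plus) blast
  note perm = permute_eigenvectors[OF p(1) P D eigen]
  obtain V1 V2 Y1 Y2 where P': "(\<chi> i j. P $ i $ p j) = block_matrix V1 V2 Y1 Y2"
    by (rule block_matrix_exists)
  obtain D1 Z Z' D2 where D': "(\<chi> i j. D $ p i $ p j) = block_matrix D1 Z Z' D2"
    by (rule block_matrix_exists)
  have diag: "diagonal_matrix D1" "Z = 0" "Z' = 0" "diagonal_matrix D2"
    using perm(2) by (simp_all add: D' diagonal_block_iff)
  have "V1 $ i $ j = X $ i $ c j" for i j
    using arg_cong[OF P', of "\<lambda>U. U $ Inl i $ Inl j"] by (simp add: X_def p(2))
  then have "V1 = (\<chi> i j. X $ i $ c j)"
    by (simp add: vec_eq_iff)
  then have "invertible V1" using c(2) by simp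
  moreover have "Y1 = V1 ** D1 \<and> Y2 = V2 ** D2 \<and>
      F ** V1 + G ** V1 ** D1 + V1 ** D1 ** D1 = 0 \<and>
      F ** V2 + G ** V2 ** D2 + V2 ** D2 ** D2 = 0"
    using perm(3) unfolding P' D' diag(2,3) companion_eigenvectors_iff .
  moreover have "invertible (block_matrix V1 V2 Y1 Y2)"
    using perm(1) unfolding P' .
  ultimately show ?R
    using diag(1,4) by blast
next
  assume ?R
  then obtain V1 V2 D1 D2 :: "complex^'n^'n" where "diagonal_matrix D1" "diagonal_matrix D2"
    and P: "invertible (block_matrix V1 V2 (V1 ** D1) (V2 ** D2))"
    and "F ** V1 + G ** V1 ** D1 + V1 ** D1 ** D1 = 0"
    and "F ** V2 + G ** V2 ** D2 + V2 ** D2 ** D2 = 0"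
    by blast
  then have "companion_matrix F G ** block_matrix V1 V2 (V1 ** D1) (V2 ** D2)
       = block_matrix V1 V2 (V1 ** D1) (V2 ** D2) ** block_matrix D1 0 0 D2"
    and "diagonal_matrix (block_matrix D1 0 0 D2)"
    by (simp_all add: companion_eigenvectors_iff diagonal_block_iff)
  with P show ?L
    unfolding diagonalizable_pencil_iff by (intro exI conjI)
qed

theorem theorem3:
  fixes A B C :: "complex^'n^'n"
  assumes "invertible A"
  shows
    "(diagonalizable_pencil (M_pencil A B C) \<longleftrightarrow>
       (\<exists>V1 Q D1 D2 :: complex^'n^'n.
          diagonal_matrix D1 \<and> diagonal_matrix D2 \<and>
          det V1 \<noteq> 0 \<and> det (D1 ** Q - Q ** D2) \<noteq> 0 \<and>
          (\<forall>l. S_pencil A B C l =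
                (mat l - left_factor V1 Q D1 D2) ** (mat l - right_factor V1 D1))))
     \<and>
     (\<forall>V1 Q D1 D2 :: complex^'n^'n.
        diagonal_matrix D1 \<longrightarrow> diagonal_matrix D2 \<longrightarrow>
        det V1 \<noteq> 0 \<longrightarrow> det (D1 ** Q - Q ** D2) \<noteq> 0 \<longrightarrow>
        ((\<forall>l. S_pencil A B C l =
               (mat l - left_factor V1 Q D1 D2) ** (mat l - right_factor V1 D1))
         \<longleftrightarrow>
         matrix_inv A ** C = left_factor V1 Q D1 D2 ** right_factor V1 D1 \<and>
         matrix_inv A ** B = - (right_factor V1 D1 + left_factor V1 Q D1 D2)))"
proof -
  let ?F = "matrix_inv A ** C" and ?G = "matrix_inv A ** B"
  have coefficients: "(\<forall>l. S_pencil A B C l = (mat l - L) ** (mat l - R)) \<longleftrightarrow>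
      ?F = L ** R \<and> ?G = - (R + L)" for L R
    unfolding S_pencil_def by (rule factorization_iff_coefficients)
  \<comment> \<open>For invertible \<open>V1\<close>, every second block \<open>V2\<close> of eigenvectors is \<open>V1 ** Q\<close> for some \<open>Q\<close>;
      this substitution turns \<open>R ** V2 - V2 ** D2\<close> into the matrix that \<open>left_factor\<close> conjugates by.\<close>
  have key: "invertible (block_matrix V1 (V1 ** Q) (V1 ** D1) (V1 ** Q ** D2)) \<and>
       ?F ** V1 + ?G ** V1 ** D1 + V1 ** D1 ** D1 = 0 \<and>
       ?F ** (V1 ** Q) + ?G ** (V1 ** Q) ** D2 + V1 ** Q ** D2 ** D2 = 0 \<longleftrightarrow>
       det (D1 ** Q - Q ** D2) \<noteq> 0 \<and>
       (\<forall>l. S_pencil A B C l = (mat l - left_factor V1 Q D1 D2) ** (mat l - right_factor V1 D1))"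
    if V1: "invertible V1" for V1 Q D1 D2
  proof -
    let ?T = "V1 ** (D1 ** Q - Q ** D2)"
    have R: "right_factor V1 D1 ** V1 = V1 ** D1"
      by (simp add: right_factor_def conjugate_mult V1)
    have T: "right_factor V1 D1 ** (V1 ** Q) - V1 ** Q ** D2 = ?T"
      by (simp add: matrix_ring_simps R)
    have invertible_T: "invertible ?T \<longleftrightarrow> det (D1 ** Q - Q ** D2) \<noteq> 0"
      using V1 by (simp add: invertible_det_nz det_mul)
    have L: "left_factor V1 Q D1 D2 ** ?T = ?T ** D2" if "invertible ?T"
      using conjugate_mult[OF that] by (simp add: left_factor_def Let_def)
    show ?thesis
      using invertible_two_solvents_iff[OF V1 R, of "V1 ** Q" D2]
        eigenvector_equations_iff_factorization[OF V1 _ R, of "V1 ** Q" D2 "left_factor V1 Q D1 D2"]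
        L
      unfolding T invertible_T coefficients by blast
  qed
  have "diagonalizable_pencil (M_pencil A B C) \<longleftrightarrow>
      diagonalizable_pencil (\<lambda>l. mat l - companion_matrix ?F ?G)"
    by (simp add: M_pencil_companion[abs_def])
  also have "\<dots> \<longleftrightarrow>
     (\<exists>(V1 :: complex^'n^'n) (Q :: complex^'n^'n) D1 D2.
        invertible V1 \<and> diagonal_matrix D1 \<and> diagonal_matrix D2 \<and>
        invertible (block_matrix V1 (V1 ** Q) (V1 ** D1) (V1 ** Q ** D2)) \<and>
        ?F ** V1 + ?G ** V1 ** D1 + V1 ** D1 ** D1 = 0 \<and>
        ?F ** (V1 ** Q) + ?G ** (V1 ** Q) ** D2 + V1 ** Q ** D2 ** D2 = 0)"
  proof -
    have param: "(\<exists>V2. \<Phi> V2) \<longleftrightarrow> (\<exists>Q. \<Phi> (V1 ** Q))" if "invertible V1"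
      for V1 :: "complex^'n^'n" and \<Phi> :: "complex^'n^'n \<Rightarrow> bool"
    proof
      assume "\<exists>V2. \<Phi> V2"
      then obtain V2 where "\<Phi> V2" by blast
      moreover have "V1 ** (matrix_inv V1 ** V2) = V2"
        by (simp add: matrix_mul_assoc matrix_inv_mult_right that)
      ultimately have "\<Phi> (V1 ** (matrix_inv V1 ** V2))" by simp
      then show "\<exists>Q. \<Phi> (V1 ** Q)" by blast
    qed blast
    have "(\<exists>V2 D1 D2. invertible V1 \<and> \<Psi> V2 D1 D2) \<longleftrightarrow>
        (\<exists>Q D1 D2. invertible V1 \<and> \<Psi> (V1 ** Q) D1 D2)"
      for V1 :: "complex^'n^'n"
        and \<Psi> :: "complex^'n^'n \<Rightarrow> complex^'n^'n \<Rightarrow> complex^'n^'n \<Rightarrow> bool"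
      by (cases "invertible V1")
        (simp_all only: param[of V1 "\<lambda>V2. \<exists>D1 D2. \<Psi> V2 D1 D2"] simp_thms)
    then show ?thesis
      unfolding companion_diagonalizable_iff by (rule ex_cong1)
  qed
  also have "\<dots> \<longleftrightarrow> (\<exists>V1 Q D1 D2. diagonal_matrix D1 \<and> diagonal_matrix D2 \<and>
          det V1 \<noteq> 0 \<and> det (D1 ** Q - Q ** D2) \<noteq> 0 \<and>
          (\<forall>l. S_pencil A B C l =
                (mat l - left_factor V1 Q D1 D2) ** (mat l - right_factor V1 D1)))"
  proof (intro ex_cong1)
    fix V1 Q D1 D2 :: "complex^'n^'n"
    show "(invertible V1 \<and> diagonal_matrix D1 \<and> diagonal_matrix D2 \<and>
        invertible (block_matrix V1 (V1 ** Q) (V1 ** D1) (V1 ** Q ** D2)) \<and>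
        ?F ** V1 + ?G ** V1 ** D1 + V1 ** D1 ** D1 = 0 \<and>
        ?F ** (V1 ** Q) + ?G ** (V1 ** Q) ** D2 + V1 ** Q ** D2 ** D2 = 0) \<longleftrightarrow>
       (diagonal_matrix D1 \<and> diagonal_matrix D2 \<and>
          det V1 \<noteq> 0 \<and> det (D1 ** Q - Q ** D2) \<noteq> 0 \<and>
          (\<forall>l. S_pencil A B C l =
                (mat l - left_factor V1 Q D1 D2) ** (mat l - right_factor V1 D1)))"
      using key[of V1 Q D1 D2] invertible_det_nz[of V1] by blast
  qed
  finally show ?thesis by (simp add: coefficients)
qed

end
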